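(* Let $J^k\in P^N(\hat D)$ and let integrals be computed using a quadrature which is exact for degree $2N$ polynomials. Then, for every $u\in P^N(\hat D)$ with coefficient vector $\boldsymbol u$, $$\boldsymbol 1^T\boldsymbol M\boldsymbol M_{1/J^k}^{-1}\boldsymbol M\boldsymbol u=\int_{\hat D}T^{-1}_{1/J^k}u\,d\hat{\boldsymbol x}=\int_{\hat D}u\,J^k\,d\hat{\boldsymbol x}.$$
   Context: $\hat D$ is the $d$-dimensional reference element; $P^N(\hat D)$ is the space of polynomials of degree at most $N$ with basis $\phi_1,\dots,\phi_{N_p}$, and $u=\sum_j\boldsymbol u_j\phi_j$. $J^k>0$ is the Jacobian determinant of the mapping from $\hat D$ to the physical element $D^k$ (here assumed, or replaced by, a degree $N$ polynomial). The quadrature has points $\hat{\boldsymbol x}_i$ and positive weights $\hat w_i$, $i=1,\dots,N_q$; $\boldsymbol W=\mathrm{diag}(\hat w_i)$, $(\boldsymbol V_q)_{ij}=\phi_j(\hat{\boldsymbol x}_i)$, $\boldsymbol M=\boldsymbol V_q^T\boldsymbol W\boldsymbol V_q$, and $\boldsymbol M_{1/J^k}=\boldsymbol V_q^T\boldsymbol W\,\mathrm{diag}(1/\boldsymbol J^k)\boldsymbol V_q$, with $\boldsymbol J^k$ the vector of values of $J^k$ at the quadrature points. The operator $T_w^{-1}$ maps $u$ to the polynomial $T_w^{-1}u\in P^N(\hat D)$ defined by $(w\,T_w^{-1}u,v)_{\hat D}=(u,v)_{\hat D}$ for all $v\in P^N(\hat D)$, where the $L^2(\hat D)$ inner products are evaluated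 with the quadrature; thus $T_{1/J^k}^{-1}u$ has coefficient vector $\boldsymbol M_{1/J^k}^{-1}\boldsymbol M\boldsymbol u$. In this statement $\boldsymbol 1$ denotes the coefficient vector of the constant function $1$ in the basis $\phi_j$ (the vector of all ones for a nodal Lagrange basis). *)

theory Defs
  imports "HOL-Analysis.Analysis"
begin

text \<open>
  Polynomial functions of total degree at most \<open>N\<close> in \<open>d = CARD('d)\<close> variables; \<open>\<alpha>\<close> ranges
  over the (finitely many) multi-indices of order at most \<open>N\<close>. Polynomials on a reference
  element \<open>D\<close> are represented by polynomial functions on the whole space, which is harmless as
  soon as \<open>D\<close> has nonempty interior, since restriction to \<open>D\<close> is then injective.
\<close>
definition poly_space :: "nat \<Rightarrow> (real^'d \<Rightarrow> real) set" where
  "poly_space N = {f. \<exists>c :: ('d \<Rightarrow> nat) \<Rightarrow> real.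
     f = (\<lambda>x. \<Sum>\<alpha> | (\<Sum>i\<in>UNIV. \<alpha> i) \<le> N. c \<alpha> * (\<Prod>i\<in>UNIV. (x $ i) ^ \<alpha> i))}"

definition lin_comb :: "('p::finite \<Rightarrow> 'x \<Rightarrow> real) \<Rightarrow> real^'p \<Rightarrow> 'x \<Rightarrow> real" where
  "lin_comb \<phi> c = (\<lambda>x. \<Sum>j\<in>UNIV. c $ j * \<phi> j x)"

definition is_basis_of :: "('p::finite \<Rightarrow> 'x \<Rightarrow> real) \<Rightarrow> ('x \<Rightarrow> real) set \<Rightarrow> bool" where
  "is_basis_of \<phi> P \<longleftrightarrow>
     (\<forall>j. \<phi> j \<in> P) \<and>
     (\<forall>c. lin_comb \<phi> c = (\<lambda>x. 0) \<longrightarrow> c = 0) \<and>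
     (\<forall>u\<in>P. \<exists>c. u = lin_comb \<phi> c)"

definition quadrature :: "('q::finite \<Rightarrow> 'x) \<Rightarrow> ('q \<Rightarrow> real) \<Rightarrow> ('x \<Rightarrow> real) \<Rightarrow> real" where
  "quadrature xq wq f = (\<Sum>i\<in>UNIV. wq i * f (xq i))"

definition quadrature_exact ::
  "(real^'d) set \<Rightarrow> ('q::finite \<Rightarrow> real^'d) \<Rightarrow> ('q \<Rightarrow> real) \<Rightarrow> nat \<Rightarrow> bool" where
  "quadrature_exact D xq wq n \<longleftrightarrow> (\<forall>f\<in>poly_space n. quadrature xq wq f = integral D f)"

definition quad_inner ::
  "('q::finite \<Rightarrow> 'x) \<Rightarrow> ('q \<Rightarrow> real) \<Rightarrow> ('x \<Rightarrow> real) \<Rightarrow> ('x \<Rightarrow> real) \<Rightarrow> real" where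
  "quad_inner xq wq f g = quadrature xq wq (\<lambda>x. f x * g x)"

definition diag_matrix :: "('q::finite \<Rightarrow> real) \<Rightarrow> real^'q^'q" where
  "diag_matrix a = (\<chi> i j. if i = j then a i else 0)"

definition vandermonde :: "('p::finite \<Rightarrow> 'x \<Rightarrow> real) \<Rightarrow> ('q::finite \<Rightarrow> 'x) \<Rightarrow> real^'p^'q" where
  "vandermonde \<phi> xq = (\<chi> i j. \<phi> j (xq i))"

definition mass_matrix ::
  "('p::finite \<Rightarrow> 'x \<Rightarrow> real) \<Rightarrow> ('q::finite \<Rightarrow> 'x) \<Rightarrow> ('q \<Rightarrow> real) \<Rightarrow> real^'p^'p" where
  "mass_matrix \<phi> xq wq =
     transpose (vandermonde \<phi> xq) ** diag_matrix wq ** vandermonde \<phi> xq"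

definition weighted_mass_matrix ::
  "('p::finite \<Rightarrow> 'x \<Rightarrow> real) \<Rightarrow> ('q::finite \<Rightarrow> 'x) \<Rightarrow> ('q \<Rightarrow> real) \<Rightarrow> ('x \<Rightarrow> real) \<Rightarrow> real^'p^'p" where
  "weighted_mass_matrix \<phi> xq wq \<omega> =
     transpose (vandermonde \<phi> xq) ** diag_matrix wq ** diag_matrix (\<lambda>i. \<omega> (xq i))
       ** vandermonde \<phi> xq"

text \<open>
  The definite description is meaningful only if such a polynomial exists uniquely, e.g. if
  \<open>\<omega>\<close> and the weights are positive at the quadrature points and the quadrature is exact for
  degree \<open>2 * N\<close> on a set with nonempty interior.
\<close>
definition T_inv ::
  "nat \<Rightarrow> ('q::finite \<Rightarrow> real^'d) \<Rightarrow> ('q \<Rightarrow> real) \<Rightarrow> (real^'d \<Rightarrow> real)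
     \<Rightarrow> (real^'d \<Rightarrow> real) \<Rightarrow> (real^'d \<Rightarrow> real)" where
  "T_inv N xq wq \<omega> u =
     (THE p. p \<in> poly_space N \<and>
        (\<forall>v\<in>poly_space N. quad_inner xq wq (\<lambda>x. \<omega> x * p x) v = quad_inner xq wq u v))"

end

theory Submission
  imports Defs
begin

text \<open>
  All three expressions are quadrature sums in disguise. Any product of two polynomials of degree at most
  \<open>N\<close> has degree at most \<open>2 * N\<close>, so exactness turns its integral into a sum over the quadrature
  points. Put \<open>p = T_inv N xq wq (\<lambda>x. 1 / J x) u\<close>. Because \<open>J\<close> itself lies in the test space, it
  may be used as the test function in the equation that defines \<open>p\<close>; the weight \<open>1 / J\<close> then
  cancels and leaves
  \<open>\<integral> p = quad_inner (p / J) J = quad_inner u J = \<integral> u * J\<close>.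

  Let \<open>M\<close> be the mass matrix and \<open>M\<^sub>\<omega>\<close> the one with weight \<open>\<omega> = 1 / J\<close>. They are the Gram matrices
  of the plain and the weighted quadrature product (\<open>inner_weighted_mass_matrix\<close>). Hence pairing
  \<open>M c\<close> with the coefficients of the constant 1 integrates the polynomial with coefficients \<open>c\<close>,
  and the matrix expression is \<open>\<integral> p\<close> as soon as \<open>p\<close> has the coefficients \<open>matrix_inv M\<^sub>\<omega> (M u)\<close>.
  That, together with existence and uniqueness of \<open>p\<close>, amounts to invertibility of \<open>M\<^sub>\<omega>\<close>
  (\<open>T_inv_lin_comb\<close>). This is positive definiteness: if \<open>c \<bullet> M\<^sub>\<omega> c = 0\<close>, the polynomial with coefficients
  \<open>c\<close> vanishes at every quadrature point; then exactness makes the integral of its square vanish,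
  so it is zero on an open subset of \<open>D\<close>, and a polynomial that is zero on a nonempty open set is
  zero everywhere (\<open>quadrature_points_unisolvent\<close>).
\<close>

section \<open>The spaces of polynomials of bounded degree\<close>

lemma finite_multi_indices: "finite {\<alpha> :: 'd::finite \<Rightarrow> nat. (\<Sum>i\<in>UNIV. \<alpha> i) \<le> N}"
proof (rule finite_subset)
  show "{\<alpha> :: 'd \<Rightarrow> nat. (\<Sum>i\<in>UNIV. \<alpha> i) \<le> N} \<subseteq> PiE UNIV (\<lambda>_. {..N})"
  proof
    fix \<alpha> :: "'d \<Rightarrow> nat" assume a: "\<alpha> \<in> {\<alpha>. (\<Sum>i\<in>UNIV. \<alpha> i) \<le> N}"
    have "\<alpha> i \<le> (\<Sum>i\<in>UNIV. \<alpha> i)" for i by (rule member_le_sum) auto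
    with a show "\<alpha> \<in> PiE UNIV (\<lambda>_. {..N})" using order_trans by auto
  qed
  show "finite (PiE (UNIV :: 'd set) (\<lambda>_. {..N}))" by (intro finite_PiE) auto
qed

lemma poly_space_monomial:
  fixes \<alpha> :: "'d::finite \<Rightarrow> nat"
  assumes "(\<Sum>i\<in>UNIV. \<alpha> i) \<le> N"
  shows "(\<lambda>x :: real^'d. c * (\<Prod>i\<in>UNIV. (x $ i) ^ \<alpha> i)) \<in> poly_space N"
  unfolding poly_space_def mem_Collect_eq
proof (intro exI[of _ "\<lambda>\<beta>. if \<beta> = \<alpha> then c else 0"] ext)
  fix x :: "real^'d"
  have "(\<Sum>\<beta> | (\<Sum>i\<in>UNIV. \<beta> i) \<le> N. (if \<beta> = \<alpha> then c else 0) * (\<Prod>i\<in>UNIV. (x $ i) ^ \<beta> i))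
      = (\<Sum>\<beta> | (\<Sum>i\<in>UNIV. \<beta> i) \<le> N. if \<beta> = \<alpha> then c * (\<Prod>i\<in>UNIV. (x $ i) ^ \<beta> i) else 0)"
    by (rule sum.cong) auto
  also have "\<dots> = c * (\<Prod>i\<in>UNIV. (x $ i) ^ \<alpha> i)"
    using assms by (simp add: sum.delta finite_multi_indices)
  finally show "c * (\<Prod>i\<in>UNIV. (x $ i) ^ \<alpha> i)
      = (\<Sum>\<beta> | (\<Sum>i\<in>UNIV. \<beta> i) \<le> N. (if \<beta> = \<alpha> then c else 0) * (\<Prod>i\<in>UNIV. (x $ i) ^ \<beta> i))" ..
qed

lemma poly_space_zero: "(\<lambda>x. 0) \<in> poly_space N"
  unfolding poly_space_def by (auto intro!: exI[of _ "\<lambda>_. 0"])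

lemma poly_space_add:
  assumes "f \<in> poly_space N" "g \<in> poly_space N"
  shows "(\<lambda>x. f x + g x) \<in> poly_space N"
proof -
  from assms obtain a b where
    "f = (\<lambda>x. \<Sum>\<alpha> | (\<Sum>i\<in>UNIV. \<alpha> i) \<le> N. a \<alpha> * (\<Prod>i\<in>UNIV. (x $ i) ^ \<alpha> i))"
    "g = (\<lambda>x. \<Sum>\<alpha> | (\<Sum>i\<in>UNIV. \<alpha> i) \<le> N. b \<alpha> * (\<Prod>i\<in>UNIV. (x $ i) ^ \<alpha> i))"
    unfolding poly_space_def by auto
  then show ?thesis
    unfolding poly_space_def
    by (auto intro!: exI[of _ "\<lambda>\<alpha>. a \<alpha> + b \<alpha>"] simp: distrib_right sum.distrib)
qed

lemma poly_space_scale: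
  assumes "f \<in> poly_space N"
  shows "(\<lambda>x. r * f x) \<in> poly_space N"
proof -
  from assms obtain a where
    "f = (\<lambda>x. \<Sum>\<alpha> | (\<Sum>i\<in>UNIV. \<alpha> i) \<le> N. a \<alpha> * (\<Prod>i\<in>UNIV. (x $ i) ^ \<alpha> i))"
    unfolding poly_space_def by auto
  then show ?thesis
    unfolding poly_space_def
    by (auto intro!: exI[of _ "\<lambda>\<alpha>. r * a \<alpha>"] simp: sum_distrib_left mult.assoc)
qed

lemma poly_space_sum:
  assumes "\<And>a. a \<in> A \<Longrightarrow> f a \<in> poly_space N"
  shows "(\<lambda>x. \<Sum>a\<in>A. f a x) \<in> poly_space N"
  using assms
  by (induction A rule: infinite_finite_induct) (auto intro: poly_space_zero poly_space_add)

lemma poly_space_mult: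
  fixes f g :: "real^'d::finite \<Rightarrow> real"
  assumes "f \<in> poly_space N" "g \<in> poly_space M"
  shows "(\<lambda>x. f x * g x) \<in> poly_space (N + M)"
proof -
  from assms obtain a b where
    f: "f = (\<lambda>x. \<Sum>\<alpha> | (\<Sum>i\<in>UNIV. \<alpha> i) \<le> N. a \<alpha> * (\<Prod>i\<in>UNIV. (x $ i) ^ \<alpha> i))" and
    g: "g = (\<lambda>x. \<Sum>\<beta> | (\<Sum>i\<in>UNIV. \<beta> i) \<le> M. b \<beta> * (\<Prod>i\<in>UNIV. (x $ i) ^ \<beta> i))"
    unfolding poly_space_def by auto
  have "(\<lambda>x. f x * g x) = (\<lambda>x. \<Sum>\<alpha> | (\<Sum>i\<in>UNIV. \<alpha> i) \<le> N. \<Sum>\<beta> | (\<Sum>i\<in>UNIV. \<beta> i) \<le> M.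
      (a \<alpha> * b \<beta>) * (\<Prod>i\<in>UNIV. (x $ i) ^ (\<alpha> i + \<beta> i)))"
    unfolding f g sum_product by (simp add: power_add prod.distrib mult_ac)
  also have "\<dots> \<in> poly_space (N + M)"
    by (intro poly_space_sum poly_space_monomial) (simp add: sum.distrib add_mono)
  finally show ?thesis .
qed

lemma poly_space_mult_double:
  assumes "f \<in> poly_space N" "g \<in> poly_space N"
  shows "(\<lambda>x. f x * g x) \<in> poly_space (2 * N)"
  using poly_space_mult[OF assms] by (simp add: mult_2)

lemma poly_space_one: "(\<lambda>x. 1) \<in> poly_space N"
  using poly_space_monomial[of "\<lambda>_. 0" N 1] by simp

lemma poly_space_continuous:
  assumes "f \<in> poly_space N"
  shows "continuous_on S f"
proof -
  from assms obtain a where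
    f: "f = (\<lambda>x. \<Sum>\<alpha> | (\<Sum>i\<in>UNIV. \<alpha> i) \<le> N. a \<alpha> * (\<Prod>i\<in>UNIV. (x $ i) ^ \<alpha> i))"
    unfolding poly_space_def by auto
  show ?thesis unfolding f by (intro continuous_intros)
qed

text \<open>
  Along a line a multivariate polynomial is a univariate one. This gives access to the fact that a
  nonzero real polynomial has finitely many roots.
\<close>
lemma poly_space_along_line:
  assumes "f \<in> poly_space N"
  shows "\<exists>q :: real poly. \<forall>t. f (a + t *\<^sub>R b) = poly q t"
proof -
  from assms obtain c where
    f: "f = (\<lambda>x. \<Sum>\<alpha> | (\<Sum>i\<in>UNIV. \<alpha> i) \<le> N. c \<alpha> * (\<Prod>i\<in>UNIV. (x $ i) ^ \<alpha> i))"
    unfolding poly_space_def by auto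
  have "\<forall>t. f (a + t *\<^sub>R b) = poly (\<Sum>\<alpha> | (\<Sum>i\<in>UNIV. \<alpha> i) \<le> N.
      smult (c \<alpha>) (\<Prod>i\<in>UNIV. [:a $ i, b $ i:] ^ \<alpha> i)) t"
    unfolding f by (simp add: poly_sum poly_prod)
  then show ?thesis ..
qed

lemma poly_space_eq_zero_if_zero_on_open:
  assumes f: "f \<in> poly_space N" and S: "open S" "a \<in> S" and z: "\<And>x. x \<in> S \<Longrightarrow> f x = 0"
  shows "f x = 0"
proof -
  obtain q where q: "\<And>t. f (a + t *\<^sub>R (x - a)) = poly q t"
    using poly_space_along_line[OF f] by blast
  have "((\<lambda>t. a + t *\<^sub>R (x - a)) \<longlongrightarrow> a + 0 *\<^sub>R (x - a)) (at 0)"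
    by (intro tendsto_intros)
  then have "\<forall>\<^sub>F t in at 0. a + t *\<^sub>R (x - a) \<in> S"
    using S by (intro topological_tendstoD) auto
  then obtain e where e: "e > 0" "\<And>t. t \<noteq> 0 \<Longrightarrow> dist t 0 < e \<Longrightarrow> a + t *\<^sub>R (x - a) \<in> S"
    unfolding eventually_at by auto
  have "{0<..<e} \<subseteq> {t. poly q t = 0}"
  proof
    fix t assume "t \<in> {0<..<e}"
    then have "a + t *\<^sub>R (x - a) \<in> S" by (intro e(2)) (auto simp: dist_real_def)
    then show "t \<in> {t. poly q t = 0}" using z q[of t] by simp
  qed
  then have "q = 0"
    using poly_roots_finite[of q] e(1) by (meson finite_subset infinite_Ioo)
  (* The point \<open>x\<close> sits at parameter 1 of the line. *)
  then show ?thesis using q[of 1] by simp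
qed

section \<open>Exact quadrature determines polynomials\<close>

lemma integrable_on_bounded_measurable:
  fixes f :: "'a::euclidean_space \<Rightarrow> real"
  assumes "D \<in> sets lebesgue" "bounded D" "continuous_on UNIV f"
  shows "f integrable_on D"
proof -
  obtain a b where ab: "D \<subseteq> cbox a b" using assms(2) bounded_subset_cbox_symmetric by blast
  have "f absolutely_integrable_on cbox a b"
    using assms(3) by (intro absolutely_integrable_continuous) (auto intro: continuous_on_subset)
  then have "f absolutely_integrable_on D"
    using assms(1) ab by (rule set_integrable_subset)
  then show ?thesis by (rule set_lebesgue_integral_eq_integral)
qed

lemma quadrature_exact_mult:
  assumes "quadrature_exact D xq wq (2 * N)" "f \<in> poly_space N" "g \<in> poly_space N"
  shows "quad_inner xq wq f g = integral D (\<lambda>x. f x * g x)"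
  using assms poly_space_mult_double unfolding quad_inner_def quadrature_exact_def by blast

text \<open>
  The square \<open>p\<^sup>2\<close> has degree at most \<open>2 * N\<close>, so the vanishing quadrature sum is a vanishing
  integral of a nonnegative continuous function. This is where the nonempty interior of \<open>D\<close>
  enters: on a null set it would say nothing about \<open>p\<close>.
\<close>
lemma quadrature_points_unisolvent:
  assumes D: "D \<in> sets lebesgue" "bounded D" "interior D \<noteq> {}"
    and ex: "quadrature_exact D xq wq (2 * N)"
    and p: "p \<in> poly_space N" and z: "\<And>i. p (xq i) = 0"
  shows "p x = 0"
proof -
  obtain y where "y \<in> interior D" using D(3) by blast
  then obtain a b where ab: "y \<in> box a b" "cbox a b \<subseteq> interior D"
    using open_contains_cbox[of "interior D"] open_interior by metis
  have cont: "continuous_on S (\<lambda>x. p x * p x)" for S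
    by (intro continuous_intros poly_space_continuous[OF p])
  have int: "(\<lambda>x. p x * p x) integrable_on D"
    using D cont by (intro integrable_on_bounded_measurable)
  have "integral (cbox a b) (\<lambda>x. p x * p x) \<le> integral D (\<lambda>x. p x * p x)"
    using ab int interior_subset
    by (intro integral_subset_le integrable_continuous cont) auto
  also have "\<dots> = quad_inner xq wq p p"
    using quadrature_exact_mult[OF ex p p] by simp
  also have "\<dots> = 0" by (simp add: quad_inner_def quadrature_def z)
  finally have "integral (cbox a b) (\<lambda>x. p x * p x) \<le> 0" .
  moreover have "0 \<le> integral (cbox a b) (\<lambda>x. p x * p x)"
    by (intro integral_nonneg integrable_continuous cont) auto
  ultimately have "integral (cbox a b) (\<lambda>x. p x * p x) = 0" by simp
  then have "p w * p w = 0" if "w \<in> cbox a b" for w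
    using integral_cbox_eq_0_iff[of a b "\<lambda>x. p x * p x"] cont ab(1) that by auto
  then have "p w = 0" if "w \<in> box a b" for w
    using that box_subset_cbox by fastforce
  then show ?thesis
    using poly_space_eq_zero_if_zero_on_open[OF p open_box ab(1)] by blast
qed

section \<open>Mass matrices as Gram matrices\<close>

lemma lin_comb_in_poly_space:
  assumes "is_basis_of \<phi> (poly_space N)"
  shows "lin_comb \<phi> c \<in> poly_space N"
  unfolding lin_comb_def
  using assms by (intro poly_space_sum poly_space_scale) (simp add: is_basis_of_def)

lemma diag_matrix_mult_vec: "diag_matrix a *v v = (\<chi> i. a i * v $ i)"
  by (simp add: vec_eq_iff diag_matrix_def matrix_vector_mult_def if_distrib sum.delta'
      if_distribR cong: if_cong)

lemma vandermonde_mult_vec: "vandermonde \<phi> xq *v c = (\<chi> i. lin_comb \<phi> c (xq i))"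
  by (simp add: vec_eq_iff vandermonde_def matrix_vector_mult_def lin_comb_def mult.commute)

text \<open>
  The bridge between matrices and functions: moving the transposed Vandermonde matrix to the other
  side of the inner product leaves only values at the quadrature points.
\<close>
lemma inner_weighted_mass_matrix:
  "c \<bullet> (weighted_mass_matrix \<phi> xq wq \<omega> *v e)
     = quad_inner xq wq (\<lambda>x. \<omega> x * lin_comb \<phi> e x) (lin_comb \<phi> c)"
proof -
  have "c \<bullet> (weighted_mass_matrix \<phi> xq wq \<omega> *v e)
      = (vandermonde \<phi> xq *v c) \<bullet>
          (diag_matrix wq *v (diag_matrix (\<lambda>i. \<omega> (xq i)) *v (vandermonde \<phi> xq *v e)))"
    unfolding weighted_mass_matrix_def
    by (simp only: matrix_vector_mul_assoc[symmetric] transpose_matrix_vector dot_lmul_matrix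
        inner_commute[of c] inner_commute[of "vandermonde \<phi> xq *v c"])
  then show ?thesis
    by (simp add: diag_matrix_mult_vec vandermonde_mult_vec quad_inner_def quadrature_def
        inner_vec_def mult_ac)
qed

lemma diag_matrix_one: "diag_matrix (\<lambda>_. 1) = mat 1"
  by (simp add: diag_matrix_def mat_def)

lemma mass_matrix_eq_weighted: "mass_matrix \<phi> xq wq = weighted_mass_matrix \<phi> xq wq (\<lambda>_. 1)"
  by (simp add: mass_matrix_def weighted_mass_matrix_def diag_matrix_one matrix_mul_rid)

lemma inner_mass_matrix:
  "c \<bullet> (mass_matrix \<phi> xq wq *v e) = quad_inner xq wq (lin_comb \<phi> e) (lin_comb \<phi> c)"
  by (simp add: mass_matrix_eq_weighted inner_weighted_mass_matrix)

text \<open>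
  The matrix is positive definite: its quadratic form is a sum of squares of point values with
  positive coefficients, and the point values determine the polynomial.
\<close>
lemma invertible_weighted_mass_matrix:
  assumes D: "D \<in> sets lebesgue" "bounded D" "interior D \<noteq> {}"
    and ex: "quadrature_exact D xq wq (2 * N)"
    and b: "is_basis_of \<phi> (poly_space N)"
    and w: "\<And>i. wq i > 0" and \<omega>: "\<And>i. \<omega> (xq i) > 0"
  shows "invertible (weighted_mass_matrix \<phi> xq wq \<omega>)"
proof -
  have "c = 0" if "weighted_mass_matrix \<phi> xq wq \<omega> *v c = 0" for c
  proof -
    let ?p = "lin_comb \<phi> c"
    have "0 = quad_inner xq wq (\<lambda>x. \<omega> x * ?p x) ?p"
      using that inner_weighted_mass_matrix[of c \<phi> xq wq \<omega> c] by simp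
    also have "\<dots> = (\<Sum>i\<in>UNIV. (wq i * \<omega> (xq i)) * (?p (xq i))\<^sup>2)"
      by (simp add: quad_inner_def quadrature_def power2_eq_square mult_ac)
    finally have "(wq i * \<omega> (xq i)) * (?p (xq i))\<^sup>2 = 0" for i
      using w \<omega> sum_nonneg_eq_0_iff[of UNIV "\<lambda>i. (wq i * \<omega> (xq i)) * (?p (xq i))\<^sup>2"]
      by (simp add: less_imp_le)
    then have "?p (xq i) = 0" for i
      using w[of i] \<omega>[of i] by (metis less_irrefl mult_eq_0_iff power2_eq_square)
    then have "?p = (\<lambda>x. 0)"
      using quadrature_points_unisolvent[OF D ex lin_comb_in_poly_space[OF b]] by blast
    then show "c = 0" using b by (simp add: is_basis_of_def)
  qed
  then show ?thesis
    by (simp add: invertible_left_inverse matrix_left_invertible_ker)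
qed

text \<open>
  Testing against \<open>poly_space N\<close> is testing against all coefficient vectors, so the variational
  equation for \<open>lin_comb \<phi> c\<close> is the linear system \<open>M\<^sub>\<omega> c = M e\<close>. Invertibility of \<open>M\<^sub>\<omega>\<close>
  therefore gives the unique existence on which the definite description in \<open>T_inv\<close> relies.
\<close>
lemma T_inv_lin_comb:
  assumes b: "is_basis_of \<phi> (poly_space N)"
    and inv: "invertible (weighted_mass_matrix \<phi> xq wq \<omega>)"
  shows "T_inv N xq wq \<omega> (lin_comb \<phi> e)
      = lin_comb \<phi> (matrix_inv (weighted_mass_matrix \<phi> xq wq \<omega>) *v (mass_matrix \<phi> xq wq *v e))"
    (is "_ = lin_comb \<phi> (matrix_inv ?W *v (?M *v e))")
    and "v \<in> poly_space N \<Longrightarrow>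
      quad_inner xq wq (\<lambda>x. \<omega> x * T_inv N xq wq \<omega> (lin_comb \<phi> e) x) v
        = quad_inner xq wq (lin_comb \<phi> e) v"
proof -
  have test: "(\<forall>v\<in>poly_space N. quad_inner xq wq (\<lambda>x. \<omega> x * lin_comb \<phi> c x) v
        = quad_inner xq wq (lin_comb \<phi> e) v) \<longleftrightarrow> ?W *v c = ?M *v e" for c
  proof -
    have "poly_space N = range (lin_comb \<phi>)"
      using b lin_comb_in_poly_space[OF b] unfolding is_basis_of_def by blast
    then have "(\<forall>v\<in>poly_space N. quad_inner xq wq (\<lambda>x. \<omega> x * lin_comb \<phi> c x) v
        = quad_inner xq wq (lin_comb \<phi> e) v)
      \<longleftrightarrow> (\<forall>d. d \<bullet> (?W *v c) = d \<bullet> (?M *v e))"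
      by (simp add: inner_weighted_mass_matrix inner_mass_matrix)
    then show ?thesis by (simp add: vector_eq_ldot)
  qed
  have "?W ** matrix_inv ?W = mat 1 \<and> matrix_inv ?W ** ?W = mat 1"
    using inv unfolding invertible_def matrix_inv_def by (rule someI_ex)
  then have left: "matrix_inv ?W ** ?W = mat 1" and right: "?W ** matrix_inv ?W = mat 1"
    by simp_all
  have solve: "?W *v c = ?M *v e \<longleftrightarrow> c = matrix_inv ?W *v (?M *v e)" for c
  proof
    assume "?W *v c = ?M *v e"
    then have "matrix_inv ?W *v (?M *v e) = (matrix_inv ?W ** ?W) *v c"
      by (simp only: matrix_vector_mul_assoc[symmetric])
    then show "c = matrix_inv ?W *v (?M *v e)" by (simp add: left)
  next
    assume "c = matrix_inv ?W *v (?M *v e)"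
    then have "?W *v c = (?W ** matrix_inv ?W) *v (?M *v e)"
      by (simp only: matrix_vector_mul_assoc[symmetric])
    then show "?W *v c = ?M *v e" by (simp add: right)
  qed
  show eq: "T_inv N xq wq \<omega> (lin_comb \<phi> e) = lin_comb \<phi> (matrix_inv ?W *v (?M *v e))"
    unfolding T_inv_def
  proof (rule the_equality)
    show "lin_comb \<phi> (matrix_inv ?W *v (?M *v e)) \<in> poly_space N \<and>
        (\<forall>v\<in>poly_space N.
          quad_inner xq wq (\<lambda>x. \<omega> x * lin_comb \<phi> (matrix_inv ?W *v (?M *v e)) x) v
          = quad_inner xq wq (lin_comb \<phi> e) v)"
      using lin_comb_in_poly_space[OF b] by (simp add: test solve)
  next
    fix p
    assume p: "p \<in> poly_space N \<and> (\<forall>v\<in>poly_space N. quad_inner xq wq (\<lambda>x. \<omega> x * p x) v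
        = quad_inner xq wq (lin_comb \<phi> e) v)"
    then obtain c where c: "p = lin_comb \<phi> c" using b unfolding is_basis_of_def by blast
    with p have "?W *v c = ?M *v e" by (simp flip: test)
    with c show "p = lin_comb \<phi> (matrix_inv ?W *v (?M *v e))" by (simp add: solve)
  qed
  show "quad_inner xq wq (\<lambda>x. \<omega> x * T_inv N xq wq \<omega> (lin_comb \<phi> e) x) v
        = quad_inner xq wq (lin_comb \<phi> e) v" if "v \<in> poly_space N"
    unfolding eq using that test solve by blast
qed

section \<open>The integral of the weight-adjusted inverse\<close>

theorem lemma2:
  fixes D :: "(real^'d) set"
    and N :: nat
    and \<phi> :: "'p::finite \<Rightarrow> real^'d \<Rightarrow> real"
    and xq :: "'q::finite \<Rightarrow> real^'d"
    and wq :: "'q \<Rightarrow> real"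
    and J u :: "real^'d \<Rightarrow> real"
    and one_vec u_vec :: "real^'p"
  assumes "D \<in> sets lebesgue" and "bounded D" and "interior D \<noteq> {}"
    and "is_basis_of \<phi> (poly_space N)"
    and "\<And>i. xq i \<in> D" and "\<And>i. wq i > 0"
    and "quadrature_exact D xq wq (2 * N)"
    and "J \<in> poly_space N" and "\<And>x. x \<in> D \<Longrightarrow> J x > 0"
    and "(\<lambda>x. 1) = lin_comb \<phi> one_vec"
    and "u \<in> poly_space N" and "u = lin_comb \<phi> u_vec"
  shows "one_vec \<bullet>
           ((mass_matrix \<phi> xq wq
             ** matrix_inv (weighted_mass_matrix \<phi> xq wq (\<lambda>x. 1 / J x))
             ** mass_matrix \<phi> xq wq) *v u_vec)
         = integral D (T_inv N xq wq (\<lambda>x. 1 / J x) u)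
       \<and> integral D (T_inv N xq wq (\<lambda>x. 1 / J x) u) = integral D (\<lambda>x. u x * J x)"
proof -
  let ?\<omega> = "\<lambda>x. 1 / J x"
  let ?M = "mass_matrix \<phi> xq wq" and ?W = "weighted_mass_matrix \<phi> xq wq ?\<omega>"
  let ?T = "T_inv N xq wq ?\<omega> u"
  note basis = \<open>is_basis_of \<phi> (poly_space N)\<close>
  note exact = \<open>quadrature_exact D xq wq (2 * N)\<close>
  have Jpos: "J (xq i) > 0" for i using assms by blast
  have inv: "invertible ?W"
    using assms Jpos by (intro invertible_weighted_mass_matrix[of D xq wq N]) auto
  have T: "?T = lin_comb \<phi> (matrix_inv ?W *v (?M *v u_vec))"
    using T_inv_lin_comb(1)[OF basis inv] \<open>u = lin_comb \<phi> u_vec\<close> by simp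
  have T_in: "?T \<in> poly_space N"
    unfolding T by (rule lin_comb_in_poly_space[OF basis])
  have int_T: "integral D ?T = quad_inner xq wq ?T (\<lambda>x. 1)"
    using quadrature_exact_mult[OF exact T_in poly_space_one] by simp
  have "one_vec \<bullet> ((?M ** matrix_inv ?W ** ?M) *v u_vec)
      = one_vec \<bullet> (?M *v (matrix_inv ?W *v (?M *v u_vec)))"
    by (simp add: matrix_vector_mul_assoc matrix_mul_assoc)
  also have "\<dots> = quad_inner xq wq ?T (\<lambda>x. 1)"
    unfolding inner_mass_matrix T \<open>(\<lambda>x. 1) = lin_comb \<phi> one_vec\<close> ..
  finally have first: "one_vec \<bullet> ((?M ** matrix_inv ?W ** ?M) *v u_vec) = integral D ?T"
    using int_T by simp
  (* The constant test function is traded for \<open>J\<close>, which cancels the weight at each point. *)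
  have "integral D ?T = quad_inner xq wq (\<lambda>x. ?\<omega> x * ?T x) J"
    unfolding int_T quad_inner_def quadrature_def
    using Jpos by (intro sum.cong) (auto simp: less_imp_neq[THEN not_sym])
  also have "\<dots> = quad_inner xq wq u J"
    using T_inv_lin_comb(2)[OF basis inv \<open>J \<in> poly_space N\<close>] \<open>u = lin_comb \<phi> u_vec\<close> by simp
  also have "\<dots> = integral D (\<lambda>x. u x * J x)"
    using exact \<open>u \<in> poly_space N\<close> \<open>J \<in> poly_space N\<close> by (rule quadrature_exact_mult)
  finally show ?thesis using first by blast
qed

end
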